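(* (1) Let $A\in\mathrm{SL}(2,\mathbb R)$ be such that $A\Lambda_q$ contains a horizontal vector $(c,0)^T$ with $0<c\le1$. Then there is a unique point $(a_A,b_A)\in\mathscr T^q$ with $A\Lambda_q=g_{a_A,b_A}\Lambda_q$, and $a_A=c$. (Uniqueness: if $(a,b),(c',d)\in\mathscr T^q$ and $g_{a,b}\Lambda_q=g_{c',d}\Lambda_q$ then $(a,b)=(c',d)$.) (2) For every $(a,b)\in\mathscr T^q$, the set $g_{a,b}\Lambda_q\cap S_1$ is nonempty and contains a vector of smallest positive slope; let $R_q(a,b)>0$ denote this slope. Then $R_q(a,b)$ is the smallest $s>0$ such that $h_sg_{a,b}\Lambda_q$ contains a horizontal vector of length at most $1$, so by (1) there is a unique point $\mathrm{BCZ}_q(a,b)\in\mathscr T^q$ with $h_{R_q(a,b)}g_{a,b}\Lambda_q=g_{\mathrm{BCZ}_q(a,b)}\Lambda_q$. (3) The sets $\mathscr T_i^q=\{(a,b)\in\mathscr T^q:(a,b)^T\cdot\mathfrak w_{i-1}^q>1,\ (a,b)^T\cdot\mathfrak w_i^q\le1\}$, $i=2,3,\dots,q-1$, form a partition of $\mathscr T^q$. If $(a,b)\in\mathscr T_i^q$, then $g_{a,b}\mathfrak w_i^q$ is the vector of least positive slope in $g_{a,b}\Lambda_q\cap S_1$, $$R_q(a,b)=\frac{y_i^q}{a\,\big((a,b)^T\cdot\mathfrak w_i^q\big)},$$ and $$\mathrm{BCZ}_q(a,b)=\Big((a,b)^T\cdot\mathfrak w_i^q,\ (a,b)^T\cdot\mathfrak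 w_{i+1}^q+k_i^q(a,b)\,\lambda_q\,(a,b)^T\cdot\mathfrak w_i^q\Big),\quad k_i^q(a,b)=\left\lfloor\frac{1-(a,b)^T\cdot\mathfrak w_{i+1}^q}{\lambda_q\,(a,b)^T\cdot\mathfrak w_i^q}\right\rfloor.$$
   Context: Fix an integer $q\ge3$, let $\lambda_q=2\cos(\pi/q)$, and let $G_q\subset \mathrm{SL}(2,\mathbb R)$ be the Hecke triangle group generated by $S=\begin{pmatrix}0&-1\\1&0\end{pmatrix}$ and $T_q=\begin{pmatrix}1&\lambda_q\\0&1\end{pmatrix}$, acting linearly on $\mathbb R^2$. Set $\Lambda_q=G_q(1,0)^T$ and $A\Lambda_q=\{A\mathbf v:\mathbf v\in\Lambda_q\}$. Let $U_q=T_qS=\begin{pmatrix}\lambda_q&-1\\1&0\end{pmatrix}$ and $\mathfrak w_i^q=(x_i^q,y_i^q)^T=U_q^i(1,0)^T$. The dot product is the standard one. Matrices: $h_s=\begin{pmatrix}1&0\\-s&1\end{pmatrix}$ ($s\in\mathbb R$), $g_{a,b}=\begin{pmatrix}a&b\\0&a^{-1}\end{pmatrix}$ ($a>0,b\in\mathbb R$); for $(a,b)$ a point, $g_{(a,b)}$ means $g_{a,b}$. For $\tau>0$, $S_\tau=\{(x,y)^T\in\mathbb R^2:0<x\le\tau\}$ is the vertical strip. The slope of $(x,y)^T$ with $x\ne0$ is $y/x$. The $G_q$-Farey triangle is $\mathscr T^q=\{(a,b)\in\mathbb R^2:0<a\le1,\ 1-\lambda_qa<b\le1\}$. *)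

theory Defs
  imports "HOL-Analysis.Analysis"
begin

text \<open>2x2 real matrices (rows given) and vectors in R^2.\<close>
definition mat2 :: "real \<Rightarrow> real \<Rightarrow> real \<Rightarrow> real \<Rightarrow> real^2^2" where
  "mat2 a b c d = vector [vector [a, b], vector [c, d]]"

definition vec2 :: "real \<Rightarrow> real \<Rightarrow> real^2" where
  "vec2 x y = vector [x, y]"

definition lam :: "nat \<Rightarrow> real" where
  "lam q = 2 * cos (pi / real q)"

definition Smat :: "real^2^2" where
  "Smat = mat2 0 (-1) 1 0"

definition Tmat :: "nat \<Rightarrow> real^2^2" where
  "Tmat q = mat2 1 (lam q) 0 1"

text \<open>The Hecke triangle group G_q: the group generated by S and T_q
  (closure of the identity under right multiplication by generators and their inverses).\<close>
inductive_set Hecke :: "nat \<Rightarrow> (real^2^2) set" for q :: nat where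
  id: "mat 1 \<in> Hecke q"
| S: "A \<in> Hecke q \<Longrightarrow> A ** Smat \<in> Hecke q"
| Sinv: "A \<in> Hecke q \<Longrightarrow> A ** matrix_inv Smat \<in> Hecke q"
| T: "A \<in> Hecke q \<Longrightarrow> A ** Tmat q \<in> Hecke q"
| Tinv: "A \<in> Hecke q \<Longrightarrow> A ** matrix_inv (Tmat q) \<in> Hecke q"

definition Lam :: "nat \<Rightarrow> (real^2) set" where
  "Lam q = {A *v vec2 1 0 | A. A \<in> Hecke q}"

definition act :: "real^2^2 \<Rightarrow> (real^2) set \<Rightarrow> (real^2) set" where
  "act A L = (\<lambda>v. A *v v) ` L"

definition Umat :: "nat \<Rightarrow> real^2^2" where
  "Umat q = mat2 (lam q) (-1) 1 0"

primrec wv :: "nat \<Rightarrow> nat \<Rightarrow> real^2" where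
  "wv q 0 = vec2 1 0"
| "wv q (Suc i) = Umat q *v wv q i"

definition hmat :: "real \<Rightarrow> real^2^2" where
  "hmat s = mat2 1 0 (-s) 1"

definition gmat :: "real \<Rightarrow> real \<Rightarrow> real^2^2" where
  "gmat a b = mat2 a b 0 (1 / a)"

definition gpt :: "real \<times> real \<Rightarrow> real^2^2" where
  "gpt p = gmat (fst p) (snd p)"

definition strip :: "real \<Rightarrow> (real^2) set" where
  "strip \<tau> = {v. 0 < v $ 1 \<and> v $ 1 \<le> \<tau>}"

definition slope :: "real^2 \<Rightarrow> real" where
  "slope v = v $ 2 / v $ 1"

definition Farey :: "nat \<Rightarrow> (real \<times> real) set" where
  "Farey q = {(a, b). 0 < a \<and> a \<le> 1 \<and> 1 - lam q * a < b \<and> b \<le> 1}"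

definition pdot :: "real \<times> real \<Rightarrow> real^2 \<Rightarrow> real" where
  "pdot p w = vec2 (fst p) (snd p) \<bullet> w"

text \<open>R_q(a,b): the least positive slope of vectors in g_{a,b} Lambda_q within S_1.\<close>
definition Rq :: "nat \<Rightarrow> real \<times> real \<Rightarrow> real" where
  "Rq q p = (LEAST s. \<exists>v \<in> act (gpt p) (Lam q) \<inter> strip 1. slope v = s \<and> 0 < s)"

definition BCZ :: "nat \<Rightarrow> real \<times> real \<Rightarrow> real \<times> real" where
  "BCZ q p = (THE p'. p' \<in> Farey q \<and>
      act (hmat (Rq q p) ** gpt p) (Lam q) = act (gpt p') (Lam q))"

definition Tpiece :: "nat \<Rightarrow> nat \<Rightarrow> (real \<times> real) set" where
  "Tpiece q i = {p \<in> Farey q. pdot p (wv q (i - 1)) > 1 \<and> pdot p (wv q i) \<le> 1}"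

definition kq :: "nat \<Rightarrow> nat \<Rightarrow> real \<times> real \<Rightarrow> int" where
  "kq q i p = \<lfloor>(1 - pdot p (wv q (i + 1))) / (lam q * pdot p (wv q i))\<rfloor>"

end

theory Submission
  imports Defs
begin

text \<open>Every vector of \<open>\<Lambda>\<^sub>q\<close> has both coordinates equal to \<open>0\<close> or of absolute value at least \<open>1\<close>:
  \<open>\<Lambda>\<^sub>q\<close> lies in a set of vectors built from \<open>(1,0)\<close> by the matrices \<open>U\<^sub>q\<^sup>k\<^sup>-\<^sup>1 T\<^sub>q\<close> and \<open>S\<close>, whose
  entries \<open>u\<^sub>k = sin (k\<pi>/q) / sin (\<pi>/q)\<close> (\<open>0 \<le> k \<le> q\<close>) are \<open>0\<close> or \<open>\<ge> 1\<close>. This discreteness pins down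
  the normal form: horizontal vectors of \<open>g\<^sub>a\<^sub>,\<^sub>b \<Lambda>\<^sub>q\<close> have length at least \<open>a\<close>, and \<open>b\<close> is determined
  modulo \<open>\<lambda>\<^sub>q a\<close>.

  For \<open>(a,b) \<in> \<T>\<^sub>i\<close> write a lattice vector as \<open>\<alpha> w\<^sub>j + \<beta> w\<^sub>j\<^sub>+\<^sub>1\<close>. The sequence \<open>(a,b)\<cdot>w\<^sub>j\<close> satisfies
  the recursion of \<open>u\<close>, hence is concave where nonnegative, so it exceeds \<open>1\<close> for \<open>1 \<le> j < i\<close>;
  since \<open>\<beta>\<close> is again a coordinate of a lattice vector, an induction on \<open>j \<le> i\<close> shows \<open>\<beta> \<ge> 0\<close>
  for every lattice vector whose image lies in the strip with positive slope. This says that \<open>g\<^sub>a\<^sub>,\<^sub>b w\<^sub>i\<close> has the least positive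
  slope \<open>R\<close>. Shearing by \<open>R\<close> makes it horizontal, and \<open>h\<^sub>R g\<^sub>a\<^sub>,\<^sub>b U\<^sub>q\<^sup>i = g\<^sub>d\<^sub>,\<^sub>-\<^sub>d\<^sub>'\<close> with
  \<open>d = (a,b)\<cdot>w\<^sub>i\<close>, \<open>d' = (a,b)\<cdot>w\<^sub>i\<^sub>-\<^sub>1\<close> gives the formula for the BCZ map after reducing the second
  coordinate modulo \<open>\<lambda>\<^sub>q d\<close>.\<close>

section \<open>Coordinates\<close>

lemma vec2_nth [simp]: "vec2 x y $ 1 = x" "vec2 x y $ 2 = y"
  by (simp_all add: vec2_def)

lemma vec2_cases: obtains x y where "v = vec2 x y"
proof
  show "v = vec2 (v$1) (v$2)" by (simp add: vec_eq_iff forall_2)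
qed

lemma vec2_eq_iff: "vec2 a b = vec2 c d \<longleftrightarrow> a = c \<and> b = d"
  by (simp add: vec_eq_iff forall_2)

lemma neg_vec2 [simp]: "- vec2 x y = vec2 (- x) (- y)"
  by (simp add: vec_eq_iff forall_2)

lemma norm_vec2_0: "norm (vec2 x 0) = \<bar>x\<bar>"
  by (simp add: norm_vec_def L2_set_def sum_2)

lemma inner_vec2 [simp]: "vec2 a b \<bullet> vec2 x y = a * x + b * y"
  by (simp add: inner_vec_def sum_2)

lemma mat2_nth [simp]:
  "mat2 a b c d $ 1 $ 1 = a" "mat2 a b c d $ 1 $ 2 = b"
  "mat2 a b c d $ 2 $ 1 = c" "mat2 a b c d $ 2 $ 2 = d"
  by (simp_all add: mat2_def)

lemma mat2_eta: "A = mat2 (A$1$1) (A$1$2) (A$2$1) (A$2$2)"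
  by (simp add: vec_eq_iff forall_2)

lemma mat2_eq_iff: "mat2 a b c d = mat2 a' b' c' d' \<longleftrightarrow> a = a' \<and> b = b' \<and> c = c' \<and> d = d'"
  by (metis mat2_nth)

lemma mat2_mulv [simp]: "mat2 a b c d *v vec2 x y = vec2 (a*x + b*y) (c*x + d*y)"
  by (simp add: vec_eq_iff forall_2 matrix_vector_mult_def sum_2)

lemma mat2_mult [simp]:
  "mat2 a b c d ** mat2 e f g h = mat2 (a*e + b*g) (a*f + b*h) (c*e + d*g) (c*f + d*h)"
  by (simp add: vec_eq_iff forall_2 matrix_matrix_mult_def sum_2)

lemma mat_1_eq_mat2: "(mat 1 :: real^2^2) = mat2 1 0 0 1"
  by (simp add: vec_eq_iff forall_2 mat_def)

lemma det_mat2 [simp]: "det (mat2 a b c d) = a*d - b*c"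
  by (simp add: det_2)

lemma matrix_inv_eqI:
  fixes A B :: "real^2^2"
  assumes "A ** B = mat 1" "B ** A = mat 1"
  shows "matrix_inv A = B"
proof -
  let ?C = "matrix_inv A"
  have C: "A ** ?C = mat 1 \<and> ?C ** A = mat 1"
    unfolding matrix_inv_def by (rule someI[of _ B]) (use assms in auto)
  have "?C = ?C ** (A ** B)" using assms by simp
  also have "\<dots> = (?C ** A) ** B" by (simp add: matrix_mul_assoc)
  finally show ?thesis using C by simp
qed

definition adj2 :: "real^2^2 \<Rightarrow> real^2^2" where
  "adj2 A = mat2 (A$2$2) (- A$1$2) (- A$2$1) (A$1$1)"

lemma adj2_mat2 [simp]: "adj2 (mat2 a b c d) = mat2 d (- b) (- c) a"
  by (simp add: adj2_def)

lemma adj2_mult: "adj2 (A ** B) = adj2 B ** adj2 A"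
  by (subst (1 2) mat2_eta[of A], subst (1 2) mat2_eta[of B]) (simp add: mat2_eq_iff algebra_simps)

lemma mult_adj2: "det A = 1 \<Longrightarrow> A ** adj2 A = mat 1"
  by (subst (asm) mat2_eta[of A], subst (1 2) mat2_eta[of A])
     (simp add: mat_1_eq_mat2 mat2_eq_iff algebra_simps)

lemma Smat_mulv [simp]: "Smat *v vec2 x y = vec2 (- y) x"
  by (simp add: Smat_def)

lemma Tmat_mulv [simp]: "Tmat q *v vec2 x y = vec2 (x + lam q * y) y"
  by (simp add: Tmat_def)

lemma Umat_mulv [simp]: "Umat q *v vec2 x y = vec2 (lam q * x - y) x"
  by (simp add: Umat_def)

lemma hmat_mulv [simp]: "hmat s *v vec2 x y = vec2 x (y - s * x)"
  by (simp add: hmat_def)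

lemma gmat_mulv [simp]: "gmat a b *v vec2 x y = vec2 (a*x + b*y) (y / a)"
  by (simp add: gmat_def)

lemma matrix_inv_Smat: "matrix_inv Smat = mat2 0 1 (-1) 0"
  by (rule matrix_inv_eqI) (simp_all add: Smat_def mat_1_eq_mat2)

lemma matrix_inv_Tmat: "matrix_inv (Tmat q) = mat2 1 (- lam q) 0 1"
  by (rule matrix_inv_eqI) (simp_all add: Tmat_def mat_1_eq_mat2)

lemma act_mult: "act (A ** B) L = act A (act B L)"
  by (auto simp: act_def matrix_vector_mul_assoc image_image)

lemma act_memI: "v \<in> L \<Longrightarrow> A *v v \<in> act A L"
  by (simp add: act_def)

lemma gmat_act_iff:
  assumes "a > 0"
  shows "z \<in> act (gmat a b) L \<longleftrightarrow> vec2 (z$1/a - b * z$2) (a * z$2) \<in> L"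
proof
  assume "z \<in> act (gmat a b) L"
  then obtain v where v: "v \<in> L" "z = gmat a b *v v" by (auto simp: act_def)
  then show "vec2 (z$1/a - b * z$2) (a * z$2) \<in> L"
    using assms by (cases v rule: vec2_cases) (simp add: field_simps)
next
  assume "vec2 (z$1/a - b * z$2) (a * z$2) \<in> L"
  moreover have "gmat a b *v vec2 (z$1/a - b * z$2) (a * z$2) = z"
    using assms by (simp add: vec_eq_iff forall_2 field_simps)
  ultimately show "z \<in> act (gmat a b) L"
    by (metis act_memI)
qed

section \<open>The sequence \<open>sin (n\<pi>/q) / sin (\<pi>/q)\<close>\<close>

fun chebU :: "nat \<Rightarrow> nat \<Rightarrow> real" where
  "chebU q 0 = 0"
| "chebU q (Suc 0) = 1"
| "chebU q (Suc (Suc n)) = lam q * chebU q (Suc n) - chebU q n"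

lemma chebU_rec: "chebU q (n + 2) = lam q * chebU q (n + 1) - chebU q n"
  by (simp add: numeral_2_eq_2)

lemma chebU_cassini: "(chebU q (n + 1))\<^sup>2 - chebU q n * chebU q (n + 2) = 1"
proof (induction n)
  case (Suc n)
  then show ?case
    using chebU_rec[of q n] chebU_rec[of q "Suc n"] by (simp add: power2_eq_square algebra_simps)
qed (simp add: numeral_2_eq_2)

lemma chebU_sin: "chebU q n * sin (pi / q) = sin (n * (pi / q))"
proof -
  define t where "t = pi / q"
  have "chebU q n * sin t = sin (n * t) \<and> chebU q (Suc n) * sin t = sin (Suc n * t)"
  proof (induction n)
    case (Suc n)
    have "chebU q (Suc (Suc n)) * sin t = 2 * cos t * sin (Suc n * t) - sin (n * t)"
      using Suc by (simp add: lam_def t_def[symmetric] algebra_simps)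
    also have "\<dots> = sin (Suc (Suc n) * t)"
      using sin_add[of "Suc n * t" t] sin_diff[of "Suc n * t" t] by (simp add: algebra_simps)
    finally show ?case using Suc by simp
  qed simp
  then show ?thesis by (simp add: t_def)
qed

lemma lam_bounds:
  assumes "q \<ge> 3"
  shows "1 \<le> lam q" "lam q < 2"
proof -
  have p0: "0 < pi / q" using assms by simp
  have p1: "pi / q \<le> pi / 3" using assms by (intro divide_left_mono) auto
  have "cos (pi / 3) \<le> cos (pi / q)"
    using p0 p1 pi_gt_zero by (intro cos_monotone_0_pi_le) linarith+
  then show "1 \<le> lam q" by (simp add: lam_def cos_60)
  have "cos (pi / q) < cos 0"
    using p0 p1 pi_gt_zero by (intro cos_monotone_0_pi) linarith+
  then show "lam q < 2" by (simp add: lam_def)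
qed

locale hecke =
  fixes q :: nat
  assumes q_ge_3: "q \<ge> 3"
begin

abbreviation u :: "nat \<Rightarrow> real" where "u \<equiv> chebU q"

lemma lam_ge_1: "1 \<le> lam q" and lam_less_2: "lam q < 2"
  using lam_bounds q_ge_3 by auto

lemma sin_pi_div_q_pos: "0 < sin (pi / q)"
  using q_ge_3 by (intro sin_gt_zero) (auto simp: divide_less_eq)

lemma u_eqI:
  assumes "sin (n * (pi / q)) = c * sin (pi / q)"
  shows "u n = c"
  using chebU_sin[of q n] assms sin_pi_div_q_pos by simp

lemma u_q: "u q = 0"
  by (rule u_eqI) (use q_ge_3 in simp)

lemma u_q_minus_1: "u (q - 1) = 1"
proof (rule u_eqI)
  have "real (q - 1) * (pi / q) = pi - pi / q"
    using q_ge_3 by (simp add: field_simps)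
  then show "sin ((q - 1) * (pi / q)) = 1 * sin (pi / q)" by simp
qed

lemma u_q_plus_1: "u (q + 1) = -1"
proof (rule u_eqI)
  have "real (q + 1) * (pi / q) = pi / q + pi"
    using q_ge_3 by (simp add: field_simps)
  then show "sin ((q + 1) * (pi / q)) = -1 * sin (pi / q)" by simp
qed

lemma u_rec: "1 \<le> k \<Longrightarrow> u (k + 1) = lam q * u k - u (k - 1)"
  using chebU_rec[of q "k - 1"] by (simp add: numeral_2_eq_2)

lemma u_q_minus_2: "u (q - 2) = lam q"
  using u_rec[of "q - 1"] q_ge_3 u_q u_q_minus_1 by (simp add: numeral_2_eq_2 Suc_diff_Suc)

lemma u_cassini: "1 \<le> i \<Longrightarrow> (u i)\<^sup>2 - u (i - 1) * u (i + 1) = 1"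
  using chebU_cassini[of q "i - 1"] by (simp add: numeral_2_eq_2)

lemma u_nonneg: "k \<le> q \<Longrightarrow> 0 \<le> u k"
proof -
  assume "k \<le> q"
  then have "0 \<le> sin (k * (pi / q))"
    using q_ge_3 by (intro sin_ge_zero) (auto simp: field_simps)
  then have "0 \<le> u k * sin (pi / q)" using chebU_sin[of q k] by simp
  then show ?thesis using sin_pi_div_q_pos by (simp add: zero_le_mult_iff)
qed

lemma u_ge_1:
  assumes "1 \<le> k" "k \<le> q - 1"
  shows "1 \<le> u k"
proof -
  define t where "t = pi / q"
  have t0: "0 < t" using q_ge_3 by (simp add: t_def)
  have t1: "t \<le> pi / 2"
  proof -
    have "t \<le> pi / 3" using q_ge_3 unfolding t_def by (intro divide_left_mono) auto
    then show ?thesis using pi_gt_zero by linarith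
  qed
  have kt1: "t \<le> k * t" using assms t0 by simp
  have kt2: "k * t \<le> pi - t"
  proof -
    have "k * t \<le> (real q - 1) * t"
      using assms q_ge_3 t0 by (intro mult_right_mono) auto
    also have "\<dots> = pi - t" using q_ge_3 by (simp add: t_def field_simps)
    finally show ?thesis .
  qed
  have "sin t \<le> sin (k * t)"
  proof (cases "k * t \<le> pi / 2")
    case True
    then show ?thesis using kt1 t0 pi_gt_zero by (intro sin_monotone_2pi_le) linarith+
  next
    case False
    have "sin t \<le> sin (pi - k * t)"
      using kt2 False t0 pi_gt_zero by (intro sin_monotone_2pi_le) linarith+
    then show ?thesis by simp
  qed
  then have "1 * sin t \<le> u k * sin t"
    using chebU_sin[of q k] by (simp add: t_def)
  then show ?thesis
    using sin_pi_div_q_pos by (simp add: t_def mult_le_cancel_right)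
qed

lemma u_increment_less_1: "2 \<le> i \<Longrightarrow> i \<le> q \<Longrightarrow> u i - u (i - 1) < 1"
proof (induction i rule: nat_induct_at_least)
  case base
  then show ?case using lam_less_2 by (simp add: numeral_2_eq_2)
next
  case (Suc n)
  \<comment> \<open>the increments decrease by \<open>(2 - lam q) * u n \<ge> 0\<close>\<close>
  have "0 \<le> (2 - lam q) * u n" using Suc lam_less_2 u_nonneg by simp
  then show ?case using Suc u_rec[of n] by (simp add: algebra_simps)
qed

lemma wv_eq: "wv q i = vec2 (u (i + 1)) (u i)"
  by (induction i) (simp_all add: vec2_eq_iff chebU_rec[simplified numeral_2_eq_2])

end

section \<open>The Hecke group and its orbit \<open>\<Lambda>\<^sub>q\<close>\<close>

lemma Hecke_mult: "B \<in> Hecke q \<Longrightarrow> A \<in> Hecke q \<Longrightarrow> A ** B \<in> Hecke q"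
proof (induction B rule: Hecke.induct)
  case id
  then show ?case by simp
next
  case (S B)
  then show ?case using Hecke.S[of "A ** B"] by (simp add: matrix_mul_assoc)
next
  case (Sinv B)
  then show ?case using Hecke.Sinv[of "A ** B"] by (simp add: matrix_mul_assoc)
next
  case (T B)
  then show ?case using Hecke.T[of "A ** B"] by (simp add: matrix_mul_assoc)
next
  case (Tinv B)
  then show ?case using Hecke.Tinv[of "A ** B"] by (simp add: matrix_mul_assoc)
qed

lemma Smat_Hecke: "Smat \<in> Hecke q"
  using Hecke.S[OF Hecke.id] by simp

lemma Tmat_Hecke: "Tmat q \<in> Hecke q"
  using Hecke.T[OF Hecke.id] by simp

lemma Smat_inv_Hecke: "mat2 0 1 (-1) 0 \<in> Hecke q"
  using Hecke.Sinv[OF Hecke.id] by (simp add: matrix_inv_Smat)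

lemma Tmat_inv_Hecke: "mat2 1 (- lam q) 0 1 \<in> Hecke q"
  using Hecke.Tinv[OF Hecke.id] by (simp add: matrix_inv_Tmat)

lemma Umat_Hecke: "Umat q \<in> Hecke q"
proof -
  have "Umat q = Tmat q ** Smat" by (simp add: Umat_def Tmat_def Smat_def)
  then show ?thesis using Hecke_mult[OF Smat_Hecke Tmat_Hecke] by simp
qed

lemma Hecke_det: "A \<in> Hecke q \<Longrightarrow> det A = 1"
proof (induction rule: Hecke.induct)
  case (S A)
  then show ?case by (simp add: det_mul Smat_def)
next
  case (Sinv A)
  then show ?case by (simp add: det_mul matrix_inv_Smat)
next
  case (T A)
  then show ?case by (simp add: det_mul Tmat_def)
next
  case (Tinv A)
  then show ?case by (simp add: det_mul matrix_inv_Tmat)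
qed simp

lemma Hecke_adj2: "A \<in> Hecke q \<Longrightarrow> adj2 A \<in> Hecke q"
proof (induction rule: Hecke.induct)
  case id
  then show ?case using Hecke.id by (simp add: mat_1_eq_mat2)
next
  case (S A)
  have "adj2 Smat = mat2 0 1 (-1) 0" by (simp add: Smat_def)
  then show ?case using S Hecke_mult Smat_inv_Hecke by (simp add: adj2_mult)
next
  case (Sinv A)
  have "adj2 (matrix_inv Smat) = Smat" unfolding matrix_inv_Smat by (simp add: Smat_def)
  then show ?case using Sinv Hecke_mult Smat_Hecke by (simp add: adj2_mult)
next
  case (T A)
  have "adj2 (Tmat q) = mat2 1 (- lam q) 0 1" by (simp add: Tmat_def)
  then show ?case using T Hecke_mult Tmat_inv_Hecke by (simp add: adj2_mult)
next
  case (Tinv A)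
  have "adj2 (matrix_inv (Tmat q)) = Tmat q" unfolding matrix_inv_Tmat by (simp add: Tmat_def)
  then show ?case using Tinv Hecke_mult Tmat_Hecke by (simp add: adj2_mult)
qed

lemma Hecke_mulv_Lam: "M \<in> Hecke q \<Longrightarrow> v \<in> Lam q \<Longrightarrow> M *v v \<in> Lam q"
  unfolding Lam_def using Hecke_mult by (auto simp: matrix_vector_mul_assoc)

lemma act_Hecke_Lam: "M \<in> Hecke q \<Longrightarrow> act M (Lam q) = Lam q"
proof
  assume M: "M \<in> Hecke q"
  show "act M (Lam q) \<subseteq> Lam q" using Hecke_mulv_Lam M by (auto simp: act_def)
  show "Lam q \<subseteq> act M (Lam q)"
  proof
    fix v assume v: "v \<in> Lam q"
    have "v = M *v (adj2 M *v v)"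
      using mult_adj2[OF Hecke_det[OF M]] by (simp add: matrix_vector_mul_assoc)
    then show "v \<in> act M (Lam q)"
      using act_memI Hecke_mulv_Lam[OF Hecke_adj2[OF M] v] by metis
  qed
qed

lemma act_mult_Hecke: "B \<in> Hecke q \<Longrightarrow> act (A ** B) (Lam q) = act A (Lam q)"
  by (simp add: act_mult act_Hecke_Lam)

lemma e1_Lam: "vec2 1 0 \<in> Lam q"
proof -
  have "vec2 1 0 = mat 1 *v vec2 1 0" by simp
  then show ?thesis unfolding Lam_def using Hecke.id by blast
qed

lemma e2_Lam: "vec2 0 1 \<in> Lam q"
  using Hecke_mulv_Lam[OF Smat_Hecke e1_Lam] by simp

lemma neg_Lam: "v \<in> Lam q \<Longrightarrow> - v \<in> Lam q"
proof -
  assume v: "v \<in> Lam q"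
  have "- v = Smat *v (Smat *v v)" by (cases v rule: vec2_cases) simp
  then show ?thesis using Hecke_mulv_Lam[OF Smat_Hecke] v by metis
qed

lemma wv_Lam: "wv q i \<in> Lam q"
  by (induction i) (simp_all add: e1_Lam Hecke_mulv_Lam Umat_Hecke)

lemma Lam_nonzero: "v \<in> Lam q \<Longrightarrow> v \<noteq> 0"
proof
  assume "v \<in> Lam q" "v = 0"
  then obtain M where M: "M \<in> Hecke q" "M *v vec2 1 0 = 0" by (auto simp: Lam_def)
  moreover have "M *v vec2 1 0 = vec2 (M$1$1) (M$2$1)"
    by (subst mat2_eta[of M]) simp
  ultimately have "M$1$1 = 0" "M$2$1 = 0" by (simp_all add: vec_eq_iff forall_2)
  then show False using Hecke_det[OF M(1)] by (simp add: det_2)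
qed

lemma act_gmat_shift:
  "act (gmat a (b + of_int n * lam q * a)) (Lam q) = act (gmat a b) (Lam q)"
proof -
  have step: "act (gmat a (b + lam q * a)) (Lam q) = act (gmat a b) (Lam q)" for b
  proof -
    have "gmat a b ** Tmat q = gmat a (b + lam q * a)"
      by (simp add: gmat_def Tmat_def algebra_simps)
    then show ?thesis using act_mult_Hecke[OF Tmat_Hecke[of q], of "gmat a b"] by simp
  qed
  have nat: "act (gmat a (b + real m * lam q * a)) (Lam q) = act (gmat a b) (Lam q)" for m b
  proof (induction m)
    case (Suc m)
    have "b + real (Suc m) * lam q * a = (b + real m * lam q * a) + lam q * a"
      by (simp add: algebra_simps)
    then show ?case using step[of "b + real m * lam q * a"] Suc by (simp only:)
  qed simp
  show ?thesis
  proof (cases "n \<ge> 0")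
    case True
    then show ?thesis using nat[of b "nat n"] by simp
  next
    case False
    then show ?thesis using nat[of "b + of_int n * lam q * a" "nat (- n)"] by simp
  qed
qed

section \<open>Discreteness of \<open>\<Lambda>\<^sub>q\<close>\<close>

definition zero_or_ge1 :: "real \<Rightarrow> bool" where
  "zero_or_ge1 x \<longleftrightarrow> x = 0 \<or> 1 \<le> x"

lemma zero_or_ge1_add: "zero_or_ge1 a \<Longrightarrow> zero_or_ge1 b \<Longrightarrow> zero_or_ge1 (a + b)"
  unfolding zero_or_ge1_def by auto

lemma zero_or_ge1_mult: "zero_or_ge1 a \<Longrightarrow> zero_or_ge1 b \<Longrightarrow> zero_or_ge1 (a * b)"
  unfolding zero_or_ge1_def by (auto intro: order.trans[OF _ mult_mono, of 1 1 1 a b, simplified])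

text \<open>\<open>diag_map q k\<close> is multiplication by \<open>U\<^sub>q\<^sup>k\<^sup>-\<^sup>1 T\<^sub>q\<close>. For \<open>1 \<le> k \<le> q - 1\<close> its entries
  are \<open>0\<close> or \<open>\<ge> 1\<close>, so it preserves the vectors lying in the closed first or third quadrant
  whose coordinates are \<open>0\<close> or \<open>\<ge> 1\<close> in absolute value; together with their images
  under \<open>S\<close> these vectors form a set containing \<open>\<Lambda>\<^sub>q\<close>.\<close>

definition diag_map :: "nat \<Rightarrow> nat \<Rightarrow> real^2 \<Rightarrow> real^2" where
  "diag_map q k v =
     vec2 (v$1 * chebU q k + v$2 * chebU q (k + 1)) (v$1 * chebU q (k - 1) + v$2 * chebU q k)"

inductive_set diag_set :: "nat \<Rightarrow> (real^2) set" for q where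
  base: "vec2 1 0 \<in> diag_set q"
| neg: "v \<in> diag_set q \<Longrightarrow> - v \<in> diag_set q"
| map: "v \<in> diag_set q \<Longrightarrow> 1 \<le> k \<Longrightarrow> k \<le> q - 1 \<Longrightarrow> diag_map q k v \<in> diag_set q"

definition invariant_set :: "nat \<Rightarrow> (real^2) set" where
  "invariant_set q = diag_set q \<union> (\<lambda>v. Smat *v v) ` diag_set q"

lemma diag_map_vec2 [simp]:
  "diag_map q k (vec2 x y) = vec2 (x * chebU q k + y * chebU q (k + 1)) (x * chebU q (k - 1) + y * chebU q k)"
  by (simp add: diag_map_def)

context hecke
begin

lemma u_zero_or_ge1: "k \<le> q \<Longrightarrow> zero_or_ge1 (u k)"
proof (cases "k = 0 \<or> k = q")
  case False
  moreover assume "k \<le> q"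
  ultimately have "1 \<le> u k" by (intro u_ge_1) auto
  then show ?thesis by (simp add: zero_or_ge1_def)
qed (auto simp: u_q zero_or_ge1_def)

lemma diag_set_coords:
  "v \<in> diag_set q \<Longrightarrow> ((0 \<le> v$1 \<and> 0 \<le> v$2) \<or> (v$1 \<le> 0 \<and> v$2 \<le> 0))
     \<and> zero_or_ge1 \<bar>v$1\<bar> \<and> zero_or_ge1 \<bar>v$2\<bar>"
proof (induction rule: diag_set.induct)
  case (map v k)
  have "zero_or_ge1 (u k)" "zero_or_ge1 (u (k + 1))" "zero_or_ge1 (u (k - 1))"
    using map.hyps by (auto intro!: u_zero_or_ge1)
  then have combine: "zero_or_ge1 (x * u k + y * u (k + 1)) \<and> zero_or_ge1 (x * u (k - 1) + y * u k)"
    if "zero_or_ge1 x" "zero_or_ge1 y" for x y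
    using that by (auto intro!: zero_or_ge1_add zero_or_ge1_mult)
  have nonneg: "zero_or_ge1 x \<Longrightarrow> 0 \<le> x" for x
    by (auto simp: zero_or_ge1_def)
  from map.IH consider "0 \<le> v$1" "0 \<le> v$2" | "v$1 \<le> 0" "v$2 \<le> 0" by auto
  then show ?case
  proof cases
    case 1
    then have "zero_or_ge1 (v$1)" "zero_or_ge1 (v$2)" using map.IH by auto
    from combine[OF this] show ?thesis using nonneg by (auto simp: diag_map_def)
  next
    case 2
    then have "zero_or_ge1 (- v$1)" "zero_or_ge1 (- v$2)" using map.IH by auto
    from combine[OF this] show ?thesis
      using nonneg by (auto simp: diag_map_def algebra_simps) (auto simp: zero_or_ge1_def)
  qed
qed (auto simp: zero_or_ge1_def)

lemma diag_map_1: "diag_map q 1 v = Tmat q *v v"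
  by (cases v rule: vec2_cases) (simp add: numeral_2_eq_2 algebra_simps)

lemma Umat_diag_map: "1 \<le> k \<Longrightarrow> Umat q *v diag_map q k v = diag_map q (k + 1) v"
proof -
  assume k: "1 \<le> k"
  have r: "u (Suc k) = lam q * u k - u (k - 1)" "u (Suc (Suc k)) = lam q * u (Suc k) - u k"
    using u_rec[of k] u_rec[of "k + 1"] k by simp_all
  show ?thesis by (cases v rule: vec2_cases) (simp add: vec2_eq_iff r algebra_simps)
qed

lemma diag_map_q: "diag_map q q v = Smat *v v"
  using u_q u_q_plus_1 u_q_minus_1 by (cases v rule: vec2_cases) simp

lemma diag_map_q_minus_1: "diag_map q (q - 1) v = vec2 (v$1) (lam q * v$1 + v$2)"
proof -
  have "q - 1 - 1 = q - 2" "q - 1 + 1 = q" using q_ge_3 by auto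
  then show ?thesis
    using u_q u_q_minus_1 u_q_minus_2 by (cases v rule: vec2_cases) (simp add: algebra_simps)
qed

lemma Tmat_inv_diag_map:
  "2 \<le> k \<Longrightarrow> mat2 1 (- lam q) 0 1 *v diag_map q k v = Smat *v diag_map q (k - 1) v"
proof -
  assume "2 \<le> k"
  then obtain m where m: "k = Suc (Suc m)" by (metis add_2_eq_Suc le_Suc_ex)
  show ?thesis unfolding m by (cases v rule: vec2_cases) (simp add: vec2_eq_iff algebra_simps)
qed

lemma invariant_set_cases:
  assumes "v \<in> invariant_set q"
  obtains "v \<in> diag_set q" | w where "w \<in> diag_set q" "v = Smat *v w"
  using assms unfolding invariant_set_def by auto

lemma invariant_set_neg: "v \<in> invariant_set q \<Longrightarrow> - v \<in> invariant_set q"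
proof (erule invariant_set_cases)
  fix w assume "w \<in> diag_set q" "v = Smat *v w"
  moreover have "- (Smat *v w) = Smat *v (- w)" by (cases w rule: vec2_cases) simp
  ultimately show "- v \<in> invariant_set q"
    unfolding invariant_set_def using diag_set.neg by auto
qed (simp add: invariant_set_def diag_set.neg)

lemma Umat_diag_set: "v \<in> diag_set q \<Longrightarrow> Umat q *v v \<in> invariant_set q"
proof (induction rule: diag_set.induct)
  case base
  have "Umat q *v vec2 1 0 = diag_map q 2 (vec2 1 0)" by (simp add: numeral_2_eq_2)
  moreover have "diag_map q 2 (vec2 1 0) \<in> diag_set q"
    using q_ge_3 by (intro diag_set.intros) auto
  ultimately show ?case by (simp add: invariant_set_def)
next
  case (neg v)
  have "Umat q *v (- v) = - (Umat q *v v)" by (cases v rule: vec2_cases) simp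
  then show ?case using invariant_set_neg neg by simp
next
  case (map v k)
  show ?case
  proof (cases "k + 1 \<le> q - 1")
    case True
    then show ?thesis using map Umat_diag_map by (simp add: invariant_set_def diag_set.map)
  next
    case False
    then have "k + 1 = q" using map by auto
    then show ?thesis using map Umat_diag_map diag_map_q by (simp add: invariant_set_def)
  qed
qed

lemma Tmat_inv_diag_set: "v \<in> diag_set q \<Longrightarrow> mat2 1 (- lam q) 0 1 *v v \<in> invariant_set q"
proof (induction rule: diag_set.induct)
  case base
  then show ?case by (simp add: invariant_set_def diag_set.base)
next
  case (neg v)
  have "mat2 1 (- lam q) 0 1 *v (- v) = - (mat2 1 (- lam q) 0 1 *v v)"
    by (cases v rule: vec2_cases) simp
  then show ?case using invariant_set_neg neg by simp
next
  case (map v k)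
  show ?case
  proof (cases "k = 1")
    case True
    have "mat2 1 (- lam q) 0 1 *v diag_map q 1 v = v"
      unfolding diag_map_1 by (cases v rule: vec2_cases) simp
    then show ?thesis using True map by (simp add: invariant_set_def)
  next
    case False
    then have "diag_map q (k - 1) v \<in> diag_set q" using map by (intro diag_set.map) auto
    then show ?thesis using map False Tmat_inv_diag_map by (simp add: invariant_set_def)
  qed
qed

lemma invariant_set_Smat: "v \<in> invariant_set q \<Longrightarrow> Smat *v v \<in> invariant_set q"
proof (erule invariant_set_cases)
  fix w assume "w \<in> diag_set q" "v = Smat *v w"
  moreover have "Smat *v (Smat *v w) = - w" by (cases w rule: vec2_cases) simp
  ultimately show "Smat *v v \<in> invariant_set q"
    unfolding invariant_set_def using diag_set.neg by auto
qed (simp add: invariant_set_def)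

lemma invariant_set_Smat_inv: "v \<in> invariant_set q \<Longrightarrow> mat2 0 1 (-1) 0 *v v \<in> invariant_set q"
proof -
  assume v: "v \<in> invariant_set q"
  have "mat2 0 1 (-1) 0 *v v = - (Smat *v v)" by (cases v rule: vec2_cases) simp
  then show ?thesis using invariant_set_neg invariant_set_Smat v by simp
qed

lemma invariant_set_Tmat: "v \<in> invariant_set q \<Longrightarrow> Tmat q *v v \<in> invariant_set q"
proof (erule invariant_set_cases)
  assume "v \<in> diag_set q"
  then have "diag_map q 1 v \<in> diag_set q" using q_ge_3 by (intro diag_set.map) auto
  then have "Tmat q *v v \<in> diag_set q" by (simp only: diag_map_1)
  then show "Tmat q *v v \<in> invariant_set q" by (simp add: invariant_set_def)
next
  fix w assume "w \<in> diag_set q" "v = Smat *v w"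
  moreover have "Tmat q *v (Smat *v w) = Umat q *v w" by (cases w rule: vec2_cases) simp
  ultimately show "Tmat q *v v \<in> invariant_set q" using Umat_diag_set by simp
qed

lemma invariant_set_Tmat_inv:
  "v \<in> invariant_set q \<Longrightarrow> mat2 1 (- lam q) 0 1 *v v \<in> invariant_set q"
proof (erule invariant_set_cases)
  fix w assume w: "w \<in> diag_set q" "v = Smat *v w"
  \<comment> \<open>\<open>T\<^sup>-\<^sup>1 S = S U\<^sup>q\<^sup>-\<^sup>2 T\<close>\<close>
  have "mat2 1 (- lam q) 0 1 *v v = Smat *v diag_map q (q - 1) w"
    using w diag_map_q_minus_1[of w] by (cases w rule: vec2_cases) (simp add: algebra_simps)
  moreover have "diag_map q (q - 1) w \<in> diag_set q"
    using w q_ge_3 by (intro diag_set.map) auto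
  ultimately show "mat2 1 (- lam q) 0 1 *v v \<in> invariant_set q" by (simp add: invariant_set_def)
qed (rule Tmat_inv_diag_set)

lemma Hecke_invariant_set: "A \<in> Hecke q \<Longrightarrow> v \<in> invariant_set q \<Longrightarrow> A *v v \<in> invariant_set q"
proof (induction arbitrary: v rule: Hecke.induct)
  case (S A)
  then show ?case by (simp add: matrix_vector_mul_assoc[symmetric] invariant_set_Smat)
next
  case (Sinv A)
  then show ?case
    by (simp add: matrix_vector_mul_assoc[symmetric] invariant_set_Smat_inv matrix_inv_Smat)
next
  case (T A)
  then show ?case by (simp add: matrix_vector_mul_assoc[symmetric] invariant_set_Tmat)
next
  case (Tinv A)
  then show ?case
    by (simp add: matrix_vector_mul_assoc[symmetric] invariant_set_Tmat_inv matrix_inv_Tmat)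
qed simp

lemma Lam_coord: "v \<in> Lam q \<Longrightarrow> v$j = 0 \<or> 1 \<le> \<bar>v$j\<bar>"
proof -
  assume "v \<in> Lam q"
  then obtain A where A: "A \<in> Hecke q" "v = A *v vec2 1 0" by (auto simp: Lam_def)
  have "vec2 1 0 \<in> invariant_set q" by (simp add: invariant_set_def diag_set.base)
  then have "v \<in> invariant_set q" using Hecke_invariant_set A by simp
  then have "zero_or_ge1 \<bar>v$1\<bar> \<and> zero_or_ge1 \<bar>v$2\<bar>"
  proof (rule invariant_set_cases)
    fix w assume "w \<in> diag_set q" "v = Smat *v w"
    then show ?thesis using diag_set_coords[of w] by (cases w rule: vec2_cases) auto
  qed (use diag_set_coords in blast)
  then show ?thesis using exhaust_2[of j] by (auto simp: zero_or_ge1_def)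
qed

end

section \<open>The normal form \<open>g\<^sub>a\<^sub>,\<^sub>b \<Lambda>\<^sub>q\<close>\<close>

context hecke
begin

lemma horizontal_length_ge:
  assumes "0 < a" "0 < c" "vec2 c 0 \<in> act (gmat a b) (Lam q)"
  shows "a \<le> c"
proof -
  have "vec2 (c / a) 0 \<in> Lam q" using assms gmat_act_iff by simp
  then have "c / a = 0 \<or> 1 \<le> \<bar>c / a\<bar>" using Lam_coord[of _ 1] by fastforce
  then show ?thesis using assms by (auto simp: field_simps)
qed

text \<open>If \<open>g\<^sub>a\<^sub>,\<^sub>b\<^sub>1 \<Lambda>\<^sub>q = g\<^sub>a\<^sub>,\<^sub>b\<^sub>2 \<Lambda>\<^sub>q\<close>, the images of \<open>(0,1)\<close> and \<open>(-\<lambda>\<^sub>q,1)\<close> under \<open>g\<^sub>a\<^sub>,\<^sub>b\<^sub>2\<close> pulled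
  back by \<open>g\<^sub>a\<^sub>,\<^sub>b\<^sub>1\<close> show that \<open>t = (b\<^sub>2 - b\<^sub>1)/a\<close> and \<open>t - \<lambda>\<^sub>q\<close> are both first coordinates in \<open>\<Lambda>\<^sub>q\<close>;
  by discreteness this is impossible for \<open>0 < t < \<lambda>\<^sub>q < 2\<close>.\<close>

lemma gmat_shift_in_Lam:
  assumes "0 < a" "act (gmat a b1) (Lam q) = act (gmat a b2) (Lam q)"
  shows "vec2 ((b2 - b1) / a) 1 \<in> Lam q" "vec2 ((b2 - b1) / a - lam q) 1 \<in> Lam q"
proof -
  have pull: "vec2 (x + (b2 - b1) * y / a) y \<in> Lam q" if "vec2 x y \<in> Lam q" for x y
  proof -
    have "gmat a b2 *v vec2 x y \<in> act (gmat a b1) (Lam q)"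
      using assms(2) act_memI[OF that] by metis
    moreover have "vec2 ((a*x + b2*y) / a - b1 * (y / a)) (a * (y / a)) = vec2 (x + (b2 - b1) * y / a) y"
      using assms(1) by (simp add: vec2_eq_iff field_simps)
    ultimately show ?thesis using gmat_act_iff[OF assms(1)] by simp
  qed
  show "vec2 ((b2 - b1) / a) 1 \<in> Lam q" using pull[OF e2_Lam] by simp
  have "vec2 (- lam q) 1 \<in> Lam q" using Hecke_mulv_Lam[OF Tmat_inv_Hecke e2_Lam] by simp
  from pull[OF this] show "vec2 ((b2 - b1) / a - lam q) 1 \<in> Lam q" by simp
qed

lemma no_shift_in_Lam:
  assumes "0 < t" "t < lam q" "vec2 t 1 \<in> Lam q" "vec2 (t - lam q) 1 \<in> Lam q"
  shows False
  using Lam_coord[OF assms(3), of 1] Lam_coord[OF assms(4), of 1] assms(1,2) lam_less_2 by auto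

lemma Farey_gmat_act_inj:
  assumes p: "(a, b) \<in> Farey q" and p': "(a', b') \<in> Farey q"
    and eq: "act (gmat a b) (Lam q) = act (gmat a' b') (Lam q)"
  shows "a = a' \<and> b = b'"
proof -
  have F: "0 < a" "a \<le> 1" "1 - lam q * a < b" "b \<le> 1"
    "0 < a'" "a' \<le> 1" "1 - lam q * a' < b'" "b' \<le> 1"
    using p p' by (auto simp: Farey_def)
  have "gmat a b *v vec2 1 0 \<in> act (gmat a' b') (Lam q)" "gmat a' b' *v vec2 1 0 \<in> act (gmat a b) (Lam q)"
    using eq act_memI[OF e1_Lam] by metis+
  then have a': "a' = a" using horizontal_length_ge F by (simp add: order_antisym)
  \<comment> \<open>two second coordinates in the range allowed by \<open>\<T>\<^sup>q\<close> differ by less than \<open>\<lambda>\<^sub>q a\<close>\<close>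
  have no_pair: False
    if "b1 < b2" "1 - lam q * a < b1" "b2 \<le> 1" "act (gmat a b1) (Lam q) = act (gmat a b2) (Lam q)"
    for b1 b2
  proof (rule no_shift_in_Lam)
    show "0 < (b2 - b1) / a" "(b2 - b1) / a < lam q" using that F by (simp_all add: field_simps)
  qed (use gmat_shift_in_Lam[OF F(1) that(4)] in auto)
  have "b = b'"
    using no_pair[of b b'] no_pair[of b' b] eq F a' by (cases b b' rule: linorder_cases) auto
  then show ?thesis using a' by simp
qed

lemma Farey_gpt_act_inj:
  "p \<in> Farey q \<Longrightarrow> p' \<in> Farey q \<Longrightarrow> act (gpt p) (Lam q) = act (gpt p') (Lam q) \<Longrightarrow> p = p'"
  using Farey_gmat_act_inj by (cases p, cases p') (auto simp: gpt_def)

lemma Farey_shift: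
  fixes b c :: real
  assumes "0 < c" "c \<le> 1"
  defines "b' \<equiv> b + of_int \<lfloor>(1 - b) / (lam q * c)\<rfloor> * lam q * c"
  shows "(c, b') \<in> Farey q" "act (gmat c b') (Lam q) = act (gmat c b) (Lam q)"
proof -
  define n where "n = \<lfloor>(1 - b) / (lam q * c)\<rfloor>"
  have lc: "0 < lam q * c" using lam_ge_1 assms by simp
  have "of_int n \<le> (1 - b) / (lam q * c)" unfolding n_def by (rule of_int_floor_le)
  then have "of_int n * (lam q * c) \<le> 1 - b" using lc by (simp add: le_divide_eq)
  moreover have "(1 - b) / (lam q * c) < of_int n + 1"
    unfolding n_def by (rule real_of_int_floor_add_one_gt)
  then have "1 - b < (of_int n + 1) * (lam q * c)" using lc by (simp add: divide_less_eq)
  ultimately show "(c, b') \<in> Farey q"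
    using assms unfolding b'_def n_def[symmetric] by (simp add: Farey_def algebra_simps)
  show "act (gmat c b') (Lam q) = act (gmat c b) (Lam q)"
    unfolding b'_def by (rule act_gmat_shift)
qed

lemma normal_form:
  assumes det: "det A = 1" and c: "0 < c" "c \<le> 1" and mem: "vec2 c 0 \<in> act A (Lam q)"
  shows "(\<exists>!p. p \<in> Farey q \<and> act A (Lam q) = act (gpt p) (Lam q))
    \<and> (\<forall>p \<in> Farey q. act A (Lam q) = act (gpt p) (Lam q) \<longrightarrow> fst p = c)"
proof -
  obtain M where M: "M \<in> Hecke q" "A *v (M *v vec2 1 0) = vec2 c 0"
    using mem by (auto simp: act_def Lam_def)
  define B where "B = A ** M"
  have "B *v vec2 1 0 = vec2 c 0" using M by (simp add: B_def matrix_vector_mul_assoc)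
  moreover have "B *v vec2 1 0 = vec2 (B$1$1) (B$2$1)" by (subst mat2_eta[of B]) simp
  ultimately have B1: "B$1$1 = c" "B$2$1 = 0" by (simp_all add: vec2_eq_iff)
  have "det B = 1" using det Hecke_det[OF M(1)] by (simp add: B_def det_mul)
  then have "B$2$2 = 1 / c" using B1 c by (subst (asm) mat2_eta[of B]) (simp add: field_simps)
  then have "B = gmat c (B$1$2)" using B1 by (subst mat2_eta[of B]) (simp add: gmat_def)
  then have actB: "act A (Lam q) = act (gmat c (B$1$2)) (Lam q)"
    using act_mult_Hecke[OF M(1), of A] by (simp add: B_def)
  obtain b where F: "(c, b) \<in> Farey q" and actb: "act A (Lam q) = act (gpt (c, b)) (Lam q)"
    using Farey_shift[OF c, of "B$1$2"] actB by (auto simp: gpt_def)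
  have uniq: "p = (c, b)" if "p \<in> Farey q" "act A (Lam q) = act (gpt p) (Lam q)" for p
    using Farey_gpt_act_inj that F actb by metis
  show ?thesis
  proof
    show "\<exists>!p. p \<in> Farey q \<and> act A (Lam q) = act (gpt p) (Lam q)"
      using F actb uniq by blast
    show "\<forall>p \<in> Farey q. act A (Lam q) = act (gpt p) (Lam q) \<longrightarrow> fst p = c"
      using uniq by fastforce
  qed
qed

end

section \<open>The pieces \<open>\<T>\<^sub>i\<close> of the Farey triangle\<close>

lemma concave_seq_ge_min:
  fixes f :: "nat \<Rightarrow> real"
  assumes concave: "\<And>k. lo < k \<Longrightarrow> k < hi \<Longrightarrow> f (Suc k) - f k \<le> f k - f (k - 1)"
    and k: "lo \<le> k" "k \<le> hi"
  shows "min (f lo) (f hi) \<le> f k"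
proof -
  define d where "d j = f (Suc j) - f j" for j
  have d_mono: "d l \<le> d j" if "lo \<le> j" "j \<le> l" "l < hi" for j l
    using that
  proof (induction l)
    case (Suc l)
    then show ?case
      using concave[of "Suc l"] by (cases "j = Suc l") (auto simp: d_def)
  qed simp
  show ?thesis
  proof (cases "\<forall>j \<in> {lo..<k}. 0 \<le> d j")
    case True
    then have "0 \<le> f k - f lo"
      using sum_Suc_diff'[OF k(1), of f] sum_nonneg[of "{lo..<k}" d] by (simp add: d_def)
    then show ?thesis by linarith
  next
    case False
    then obtain j where j: "lo \<le> j" "j < k" "d j < 0" by auto
    have "d l \<le> 0" if "l \<in> {k..<hi}" for l
      using d_mono[of j l] j that by fastforce
    then have "f hi - f k \<le> 0"
      using sum_Suc_diff'[OF k(2), of f] sum_nonpos[of "{k..<hi}" d] by (simp add: d_def)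
    then show ?thesis by linarith
  qed
qed

definition wdot :: "nat \<Rightarrow> real \<Rightarrow> real \<Rightarrow> nat \<Rightarrow> real" where
  "wdot q a b j = a * chebU q (j + 1) + b * chebU q j"

context hecke
begin

lemma pdot_wv: "pdot (a, b) (wv q j) = wdot q a b j"
  by (simp add: pdot_def wv_eq wdot_def)

lemma wdot_0: "wdot q a b 0 = a"
  by (simp add: wdot_def)

lemma wdot_1: "wdot q a b 1 = lam q * a + b"
  by (simp add: wdot_def numeral_2_eq_2)

lemma wdot_q_minus_1: "wdot q a b (q - 1) = b"
  using q_ge_3 u_q u_q_minus_1 by (simp add: wdot_def)

lemma wdot_rec: "1 \<le> j \<Longrightarrow> wdot q a b (j + 1) = lam q * wdot q a b j - wdot q a b (j - 1)"
proof -
  assume "1 \<le> j"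
  then obtain m where j: "j = Suc m" by (cases j) auto
  have r: "u (Suc j) = lam q * u j - u m" "u (Suc (Suc j)) = lam q * u (Suc j) - u j"
    using u_rec[of j] u_rec[of "j + 1"] j by simp_all
  show ?thesis by (simp add: wdot_def r j algebra_simps)
qed

lemma wdot_cassini: "1 \<le> i \<Longrightarrow> u i * wdot q a b (i - 1) - u (i - 1) * wdot q a b i = a"
proof -
  assume "1 \<le> i"
  then obtain m where i: "i = Suc m" by (cases i) auto
  have "u i * wdot q a b (i - 1) - u (i - 1) * wdot q a b i = a * ((u i)\<^sup>2 - u (i - 1) * u (i + 1))"
    unfolding i by (simp add: wdot_def power2_eq_square algebra_simps)
  then show ?thesis using u_cassini[of i] i by simp
qed

lemma Farey_wdot_1: "(a, b) \<in> Farey q \<Longrightarrow> wdot q a b 1 > 1"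
  using wdot_1[of a b] by (simp add: Farey_def)

lemma wdot_pos_next:
  assumes "0 < a" "a \<le> 1" "1 \<le> i" "i \<le> q - 1" "wdot q a b (i - 1) > 1"
  shows "wdot q a b i > 0"
proof (rule ccontr)
  assume "\<not> wdot q a b i > 0"
  then have "u (i - 1) * wdot q a b i \<le> 0"
    using u_nonneg[of "i - 1"] assms by (simp add: mult_nonneg_nonpos)
  then have "u i * wdot q a b (i - 1) \<le> a"
    using wdot_cassini[of i a b] assms by simp
  moreover have "u i * 1 < u i * wdot q a b (i - 1)"
    using u_ge_1[of i] assms by (intro mult_strict_left_mono) auto
  ultimately show False using u_ge_1[of i] assms by linarith
qed

lemma wdot_neg_next:
  assumes "0 < a" "1 \<le> k" "k + 1 \<le> q" "wdot q a b k \<le> 0"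
  shows "wdot q a b (k + 1) < 0"
proof -
  have "u (k + 1) * wdot q a b k \<le> 0"
    using assms u_nonneg[of "k + 1"] by (simp add: mult_nonneg_nonpos)
  then have "u k * wdot q a b (k + 1) < 0"
    using wdot_cassini[of "k + 1" a b] assms by simp
  moreover have "1 \<le> u k" using assms by (intro u_ge_1) arith+
  ultimately show ?thesis by (simp add: mult_less_0_iff)
qed

lemma wdot_pos_before:
  assumes "0 < a" "m \<le> q - 1" "wdot q a b m > 0" "1 \<le> k" "k \<le> m"
  shows "wdot q a b k > 0"
proof (rule ccontr)
  assume k: "\<not> wdot q a b k > 0"
  have neg: "wdot q a b j < 0" if "k < j" "j \<le> q" for j
    using that
  proof (induction j)
    case (Suc j)
    then have "wdot q a b j \<le> 0" using k by (cases "j = k") auto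
    then show ?case using wdot_neg_next[of a j b] assms Suc by simp
  qed simp
  show False
  proof (cases "k = m")
    case False
    moreover have "m \<le> q" using assms by arith
    ultimately have "wdot q a b m < 0" using neg[of m] assms by simp
    then show False using assms by simp
  qed (use assms k in simp)
qed

lemma wdot_gt_1:
  assumes F: "(a, b) \<in> Farey q" and i: "i \<le> q - 1" "wdot q a b (i - 1) > 1"
    and j: "1 \<le> j" "j \<le> i - 1"
  shows "wdot q a b j > 1"
proof -
  have a: "0 < a" using F by (simp add: Farey_def)
  have "min (wdot q a b 1) (wdot q a b (i - 1)) \<le> wdot q a b j"
  proof (rule concave_seq_ge_min[OF _ j])
    fix k assume k: "1 < k" "k < i - 1"
    then have "0 \<le> wdot q a b k"
      using wdot_pos_before[OF a _ _, of "i - 1" b k] i by (simp add: less_imp_le)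
    then have "lam q * wdot q a b k \<le> 2 * wdot q a b k"
      using lam_less_2 by (simp add: mult_right_mono)
    then show "wdot q a b (Suc k) - wdot q a b k \<le> wdot q a b k - wdot q a b (k - 1)"
      using wdot_rec[of k a b] k by simp
  qed
  then show ?thesis using Farey_wdot_1[OF F] i by linarith
qed

lemma Tpiece_iff:
  "(a, b) \<in> Tpiece q i \<longleftrightarrow> (a, b) \<in> Farey q \<and> wdot q a b (i - 1) > 1 \<and> wdot q a b i \<le> 1"
  by (simp add: Tpiece_def pdot_wv)

lemma Tpiece_nonempty:
  assumes i: "2 \<le> i" "i \<le> q - 1"
  shows "Tpiece q i \<noteq> {}"
proof -
  \<comment> \<open>the witness lies on the right edge \<open>a = 1\<close>, on the line \<open>(a,b)\<cdot>w\<^sub>i = 1\<close>\<close>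
  define b where "b = (1 - u (i + 1)) / u i"
  have ui: "1 \<le> u i" using u_ge_1 i by simp
  have incr: "u i - u (i - 1) < 1" using i by (intro u_increment_less_1) auto
  have bu: "b * u i = 1 - u (i + 1)" using ui by (simp add: b_def)
  have wi: "wdot q 1 b i = 1" using bu by (simp add: wdot_def)
  have "u i * wdot q 1 b (i - 1) = 1 + u (i - 1)"
    using wdot_cassini[of i 1 b] wi i by simp
  also have "\<dots> > u i * 1" using incr by simp
  finally have wi1: "wdot q 1 b (i - 1) > 1" using ui by (simp add: mult_less_cancel_left)
  have "0 \<le> u (i + 1)" using i by (intro u_nonneg) arith
  then have "b * u i \<le> 1 * u i" using bu ui by simp
  then have b1: "b \<le> 1" using ui by (simp add: mult_le_cancel_right)
  have "(1 - lam q) * u i < b * u i"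
    using bu u_rec[of i] incr i by (simp add: algebra_simps)
  then have b2: "1 - lam q < b" using ui by (simp add: mult_less_cancel_right)
  have "(1, b) \<in> Tpiece q i" using wi wi1 b1 b2 by (simp add: Tpiece_iff Farey_def)
  then show ?thesis by blast
qed

lemma Tpiece_Union: "(\<Union>i \<in> {2..q-1}. Tpiece q i) = Farey q"
proof
  show "(\<Union>i \<in> {2..q-1}. Tpiece q i) \<subseteq> Farey q" by (auto simp: Tpiece_def)
  show "Farey q \<subseteq> (\<Union>i \<in> {2..q-1}. Tpiece q i)"
  proof (clarify)
    fix a b assume F: "(a, b) \<in> Farey q"
    define P where "P j \<longleftrightarrow> 2 \<le> j \<and> wdot q a b j \<le> 1" for j
    have "P (q - 1)" using q_ge_3 F wdot_q_minus_1[of a b] by (auto simp: P_def Farey_def)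
    define i where "i = (LEAST j. P j)"
    have Pi: "P i" and iq: "i \<le> q - 1"
      unfolding i_def using \<open>P (q - 1)\<close> by (auto intro: LeastI Least_le)
    have "wdot q a b (i - 1) > 1"
    proof (cases "i - 1 = 1")
      case True
      then show ?thesis using Farey_wdot_1[OF F] by simp
    next
      case False
      then have "i - 1 < i" "2 \<le> i - 1" using Pi by (auto simp: P_def)
      then have "\<not> P (i - 1)" unfolding i_def using not_less_Least by blast
      then show ?thesis using \<open>2 \<le> i - 1\<close> by (simp add: P_def)
    qed
    then show "(a, b) \<in> (\<Union>i \<in> {2..q-1}. Tpiece q i)"
      using F Pi iq by (auto simp: Tpiece_iff P_def)
  qed
qed

lemma Tpiece_disjoint:
  assumes "i \<in> {2..q-1}" "j \<in> {2..q-1}" "i \<noteq> j"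
  shows "Tpiece q i \<inter> Tpiece q j = {}"
proof -
  have ordered: "Tpiece q i \<inter> Tpiece q j = {}" if "i < j" "2 \<le> i" "j \<le> q - 1" for i j
  proof (rule ccontr)
    assume "Tpiece q i \<inter> Tpiece q j \<noteq> {}"
    then obtain a b where "(a, b) \<in> Tpiece q i" "(a, b) \<in> Tpiece q j" by auto
    then have "(a, b) \<in> Farey q" "wdot q a b i \<le> 1" "wdot q a b (j - 1) > 1"
      by (auto simp: Tpiece_iff)
    moreover have "i \<le> j - 1" using that by simp
    ultimately show False using wdot_gt_1[of a b j i] that by simp
  qed
  then show ?thesis
    using ordered[of i j] ordered[of j i] assms by (cases "i < j") (auto simp: Int_commute)
qed

end

section \<open>The vector of least slope\<close>

context hecke
begin

lemma Umat_power_Hecke: "mat2 (u (m + 2)) (- u (m + 1)) (u (m + 1)) (- u m) \<in> Hecke q"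
proof (induction m)
  case 0
  then show ?case using Umat_Hecke by (simp add: Umat_def numeral_2_eq_2)
next
  case (Suc m)
  have "mat2 (u (Suc m + 2)) (- u (Suc m + 1)) (u (Suc m + 1)) (- u (Suc m))
      = Umat q ** mat2 (u (m + 2)) (- u (m + 1)) (u (m + 1)) (- u m)"
    by (simp add: Umat_def numeral_2_eq_2 algebra_simps)
  then show ?case using Hecke_mult[OF Suc Umat_Hecke] by simp
qed

text \<open>Pairing with \<open>U\<^sub>q\<^sup>-\<^sup>(\<^sup>j\<^sup>+\<^sup>1\<^sup>)\<close> shows that the coordinate of a lattice vector along \<open>w\<^sub>j\<^sub>+\<^sub>1\<close> in the
  basis \<open>w\<^sub>j, w\<^sub>j\<^sub>+\<^sub>1\<close> is itself a coordinate of a vector of \<open>\<Lambda>\<^sub>q\<close>.\<close>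

lemma Lam_wcoord: "vec2 x y \<in> Lam q \<Longrightarrow> u (j + 1) * y - u j * x = 0 \<or> 1 \<le> \<bar>u (j + 1) * y - u j * x\<bar>"
proof -
  assume "vec2 x y \<in> Lam q"
  moreover have "mat2 (- u j) (u (j + 1)) (- u (j + 1)) (u (j + 2)) \<in> Hecke q"
    using Hecke_adj2[OF Umat_power_Hecke[of j]] by simp
  ultimately have "vec2 (u (j + 1) * y - u j * x) (u (j + 2) * y - u (j + 1) * x) \<in> Lam q"
    using Hecke_mulv_Lam by fastforce
  from Lam_coord[OF this, of 1] show ?thesis by simp
qed

lemma wdot_decomp:
  "a * x + b * y = (u (j + 1) * x - u (j + 2) * y) * wdot q a b j + (u (j + 1) * y - u j * x) * wdot q a b (j + 1)"
proof -
  have "(u (j + 1) * x - u (j + 2) * y) * wdot q a b j + (u (j + 1) * y - u j * x) * wdot q a b (j + 1)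
      = (a * x + b * y) * ((u (j + 1))\<^sup>2 - u j * u (j + 2))"
    by (simp add: wdot_def power2_eq_square algebra_simps)
  then show ?thesis using chebU_cassini[of q j] by simp
qed

lemma wdot_pos_upto:
  assumes F: "(a, b) \<in> Farey q" and i: "2 \<le> i" "i \<le> q - 1" "wdot q a b (i - 1) > 1"
    and j: "1 \<le> j" "j \<le> i"
  shows "wdot q a b j > 0"
proof (cases "j = i")
  case True
  then show ?thesis using wdot_pos_next[of a i b] F i by (simp add: Farey_def)
next
  case False
  then have "j \<le> i - 1" using j by arith
  then show ?thesis using wdot_gt_1[OF F i(2,3), of j] j by simp
qed

lemma Lam_wcoord_nonneg:
  assumes F: "(a, b) \<in> Farey q" and i: "2 \<le> i" "i \<le> q - 1" "wdot q a b (i - 1) > 1"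
    and v: "vec2 x y \<in> Lam q" and strip: "0 < a * x + b * y" "a * x + b * y \<le> 1" and y: "0 < y"
    and j: "j \<le> i"
  shows "0 \<le> u (j + 1) * y - u j * x"
  using j
proof (induction j)
  case 0
  then show ?case using y by simp
next
  case (Suc j)
  have a: "0 < a" "a \<le> 1" using F by (auto simp: Farey_def)
  define \<alpha> where "\<alpha> = u (j + 1) * x - u (j + 2) * y"
  define \<beta> where "\<beta> = u (j + 1) * y - u j * x"
  have \<beta>: "0 \<le> \<beta>" using Suc by (simp add: \<beta>_def)
  have pos: "wdot q a b (j + 1) > 0" using wdot_pos_upto[OF F i] Suc.prems by simp
  show ?case
  proof (rule ccontr)
    assume "\<not> 0 \<le> u (Suc j + 1) * y - u (Suc j) * x"
    \<comment> \<open>then \<open>\<alpha> \<ge> 1\<close>, and the decomposition puts \<open>(a,b)\<cdot>(x,y)\<close> above \<open>1\<close>\<close>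
    then have "1 \<le> \<alpha>"
      using Lam_wcoord[OF v, of "j + 1"] by (auto simp: \<alpha>_def numeral_2_eq_2)
    have sum: "a * x + b * y = \<alpha> * wdot q a b j + \<beta> * wdot q a b (j + 1)"
      unfolding \<alpha>_def \<beta>_def by (rule wdot_decomp)
    show False
    proof (cases "j = 0")
      case True
      have "1 \<le> \<beta>" using Lam_coord[OF v, of 2] y True by (auto simp: \<beta>_def)
      then have "1 * wdot q a b 1 \<le> \<beta> * wdot q a b 1"
        using True pos by (intro mult_right_mono) auto
      moreover have "1 * a \<le> \<alpha> * a" using \<open>1 \<le> \<alpha>\<close> a by (intro mult_right_mono) auto
      moreover have "a * x + b * y = \<alpha> * a + \<beta> * wdot q a b 1" using sum True by (simp add: wdot_0)
      ultimately show False using strip a Farey_wdot_1[OF F] by linarith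
    next
      case False
      then have "wdot q a b j > 1" using wdot_gt_1[OF F i(2,3), of j] Suc.prems by simp
      then have "1 * wdot q a b j \<le> \<alpha> * wdot q a b j" using \<open>1 \<le> \<alpha>\<close> by (intro mult_right_mono) auto
      moreover have "0 \<le> \<beta> * wdot q a b (j + 1)" using \<beta> pos by simp
      ultimately show False using sum strip \<open>wdot q a b j > 1\<close> by linarith
    qed
  qed
qed

lemma Tpiece_min_slope:
  assumes i: "2 \<le> i" "i \<le> q - 1" and T: "(a, b) \<in> Tpiece q i"
  defines "d \<equiv> wdot q a b i" and "v \<equiv> gmat a b *v wv q i"
  shows "v = vec2 d (u i / a)" "0 < d" "d \<le> 1" "0 < a"
    "v \<in> act (gmat a b) (Lam q) \<inter> strip 1"
    "slope v = u i / (a * d)" "0 < slope v"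
    "\<forall>z \<in> act (gmat a b) (Lam q) \<inter> strip 1. 0 < slope z \<longrightarrow> slope v \<le> slope z"
proof -
  have F: "(a, b) \<in> Farey q" and wi1: "wdot q a b (i - 1) > 1" and wi: "wdot q a b i \<le> 1"
    using T by (auto simp: Tpiece_iff)
  have a: "0 < a" "a \<le> 1" using F by (auto simp: Farey_def)
  then show "0 < a" by simp
  show v: "v = vec2 d (u i / a)" by (simp add: v_def d_def wv_eq wdot_def)
  show d: "0 < d" "d \<le> 1" using wdot_pos_next[OF a, of i b] i wi1 wi by (simp_all add: d_def)
  have "v \<in> act (gmat a b) (Lam q)" unfolding v_def by (rule act_memI[OF wv_Lam])
  then show "v \<in> act (gmat a b) (Lam q) \<inter> strip 1" using d v by (simp add: strip_def)
  show slope: "slope v = u i / (a * d)" using v by (simp add: slope_def)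
  have ui: "1 \<le> u i" using u_ge_1 i by simp
  then show "0 < slope v" using slope a d by simp
  show "\<forall>z \<in> act (gmat a b) (Lam q) \<inter> strip 1. 0 < slope z \<longrightarrow> slope v \<le> slope z"
  proof (intro ballI impI)
    fix z assume z: "z \<in> act (gmat a b) (Lam q) \<inter> strip 1" and sz: "0 < slope z"
    then obtain x y where w: "vec2 x y \<in> Lam q" "z = vec2 (a * x + b * y) (y / a)"
      by (auto simp: act_def elim!: vec2_cases[of _ "_"]) (metis gmat_mulv vec2_cases)
    define P where "P = a * x + b * y"
    have P: "0 < P" "P \<le> 1" using z w by (simp_all add: strip_def P_def)
    have "0 < (y / a) / P" using sz w by (simp add: slope_def P_def)
    then have y: "0 < y" using P a by (auto simp: zero_less_divide_iff mult_less_0_iff)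
    have "u i * x \<le> u (i + 1) * y"
      using Lam_wcoord_nonneg[OF F i wi1 w(1) _ _ y, of i] P by (simp add: P_def)
    then have "u i * P \<le> y * d"
      using a(1) by (simp add: P_def d_def wdot_def algebra_simps mult_left_mono)
    then have "u i / (a * d) \<le> y / (a * P)"
      using a d P by (simp add: divide_le_eq le_divide_eq field_simps)
    then show "slope v \<le> slope z" using slope w by (simp add: slope_def P_def)
  qed
qed

end

section \<open>The BCZ map\<close>

lemma no_short_horizontal_below_min_slope:
  assumes neg: "\<And>v. v \<in> M \<Longrightarrow> - v \<in> M" and nonzero: "0 \<notin> M"
    and min: "\<forall>z \<in> M \<inter> strip 1. 0 < slope z \<longrightarrow> r \<le> slope z" and s: "0 < s" "s < r"
  shows "\<not> (\<exists>v \<in> act (hmat s) M. v$2 = 0 \<and> norm v \<le> 1)"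
proof
  assume "\<exists>v \<in> act (hmat s) M. v$2 = 0 \<and> norm v \<le> 1"
  then obtain w where w: "w \<in> M" "(hmat s *v w)$2 = 0" "norm (hmat s *v w) \<le> 1"
    by (auto simp: act_def)
  obtain X Y where XY: "w = vec2 X Y" by (rule vec2_cases)
  have z: "vec2 X Y \<in> M" and Y: "Y = s * X" and X: "\<bar>X\<bar> \<le> 1"
    using w XY by (simp_all add: norm_vec2_0)
  have "vec2 0 0 = 0" by (simp add: vec_eq_iff forall_2)
  then have "X \<noteq> 0" using z Y nonzero by auto
  \<comment> \<open>\<open>\<pm>(X,Y)\<close> lies in the strip and has slope \<open>s < r\<close>\<close>
  then have "vec2 X Y \<in> M \<inter> strip 1 \<or> vec2 (- X) (- Y) \<in> M \<inter> strip 1"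
    using z neg[OF z] X by (auto simp: strip_def)
  moreover have "slope (vec2 X Y) = s" "slope (vec2 (- X) (- Y)) = s"
    using Y \<open>X \<noteq> 0\<close> by (simp_all add: slope_def)
  ultimately obtain z where "z \<in> M \<inter> strip 1" "slope z = s" by blast
  then show False using bspec[OF min] s by fastforce
qed

context hecke
begin

lemma Rq_eqI:
  assumes "v \<in> act (gpt p) (Lam q) \<inter> strip 1" "0 < slope v"
    and "\<forall>z \<in> act (gpt p) (Lam q) \<inter> strip 1. 0 < slope z \<longrightarrow> slope v \<le> slope z"
  shows "Rq q p = slope v"
  unfolding Rq_def using assms by (intro Least_equality) auto

lemma BCZ_eqI:
  assumes "p' \<in> Farey q" "act (hmat (Rq q p) ** gpt p) (Lam q) = act (gpt p') (Lam q)"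
  shows "BCZ q p = p'"
  unfolding BCZ_def using assms Farey_gpt_act_inj by (intro the_equality) auto

lemma shear_gmat_Umat_power:
  assumes i: "1 \<le> i" and a: "0 < a" and d: "wdot q a b i \<noteq> 0"
  shows "hmat (u i / (a * wdot q a b i)) ** gmat a b ** mat2 (u (i + 1)) (- u i) (u i) (- u (i - 1))
    = gmat (wdot q a b i) (- wdot q a b (i - 1))"
proof -
  define d d' R where "d = wdot q a b i" and "d' = wdot q a b (i - 1)" and "R = u i / (a * d)"
  have "gmat a b ** mat2 (u (i + 1)) (- u i) (u i) (- u (i - 1))
      = mat2 d (- d') (u i / a) (- u (i - 1) / a)"
    using i by (simp add: gmat_def d_def d'_def wdot_def mat2_eq_iff)
  then have "hmat R ** gmat a b ** mat2 (u (i + 1)) (- u i) (u i) (- u (i - 1))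
      = mat2 d (- d') (u i / a - R * d) (R * d' - u (i - 1) / a)"
    by (simp add: matrix_mul_assoc[symmetric] hmat_def)
  moreover have "u i / a - R * d = 0" using a d by (simp add: R_def d_def)
  moreover have "R * d' - u (i - 1) / a = (u i * d' - u (i - 1) * d) / (a * d)"
    using a d by (simp add: R_def d_def field_simps)
  then have "R * d' - u (i - 1) / a = 1 / d"
    using wdot_cassini[OF i, of a b] a by (simp add: d_def d'_def)
  ultimately show ?thesis by (simp add: gmat_def R_def d_def d'_def)
qed

lemma Tpiece_BCZ:
  assumes i: "2 \<le> i" "i \<le> q - 1" and T: "(a, b) \<in> Tpiece q i"
  defines "d \<equiv> wdot q a b i"
  shows "Rq q (a, b) = u i / (a * d)"
    "hmat (Rq q (a, b)) ** gpt (a, b) *v wv q i = vec2 d 0"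
    "BCZ q (a, b) = (d, wdot q a b (i + 1) + of_int \<lfloor>(1 - wdot q a b (i + 1)) / (lam q * d)\<rfloor> * lam q * d)"
proof -
  note min = Tpiece_min_slope[OF i T, folded d_def]
  show R: "Rq q (a, b) = u i / (a * d)"
    using Rq_eqI[of "gmat a b *v wv q i"] min by (simp add: gpt_def)
  show "hmat (Rq q (a, b)) ** gpt (a, b) *v wv q i = vec2 d 0"
    using R min by (simp add: gpt_def matrix_vector_mul_assoc[symmetric])
  \<comment> \<open>\<open>h\<^sub>R g\<^sub>a\<^sub>,\<^sub>b U\<^sub>q\<^sup>i = g\<^sub>d\<^sub>,\<^sub>-\<^sub>d\<^sub>'\<close>, and \<open>-d' = e - \<lambda>\<^sub>q d\<close>\<close>
  define U where "U = mat2 (u (i + 1)) (- u i) (u i) (- u (i - 1))"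
  define e where "e = wdot q a b (i + 1)"
  have "U \<in> Hecke q"
    using Umat_power_Hecke[of "i - 1"] i by (simp add: U_def numeral_2_eq_2 Suc_diff_Suc)
  then have "act (hmat (Rq q (a, b)) ** gpt (a, b)) (Lam q) = act (hmat (Rq q (a, b)) ** gpt (a, b) ** U) (Lam q)"
    by (simp add: act_mult_Hecke)
  also have "hmat (Rq q (a, b)) ** gpt (a, b) ** U = gmat d (e + of_int (-1) * lam q * d)"
    using shear_gmat_Umat_power[of i a b] wdot_rec[of i a b] i min(2,4)
    by (simp add: R U_def gpt_def d_def e_def)
  also have "act \<dots> (Lam q) = act (gmat d e) (Lam q)"
    by (rule act_gmat_shift)
  finally have "act (hmat (Rq q (a, b)) ** gpt (a, b)) (Lam q) = act (gmat d e) (Lam q)" .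
  then show "BCZ q (a, b) = (d, e + of_int \<lfloor>(1 - e) / (lam q * d)\<rfloor> * lam q * d)"
    using Farey_shift[of d e] min(2,3) by (intro BCZ_eqI) (simp_all add: gpt_def)
qed

lemma act_gmat_Lam_neg: "v \<in> act (gmat a b) (Lam q) \<Longrightarrow> - v \<in> act (gmat a b) (Lam q)"
proof -
  assume "v \<in> act (gmat a b) (Lam q)"
  then obtain w where w: "w \<in> Lam q" "v = gmat a b *v w" by (auto simp: act_def)
  then have "- v = gmat a b *v (- w)" by (cases w rule: vec2_cases) simp
  then show ?thesis using act_memI[OF neg_Lam[OF w(1)]] by metis
qed

lemma act_gmat_Lam_nonzero: "0 < a \<Longrightarrow> 0 \<notin> act (gmat a b) (Lam q)"
proof
  assume a: "0 < a" and "0 \<in> act (gmat a b) (Lam q)"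
  then obtain w where w: "w \<in> Lam q" "gmat a b *v w = 0" by (auto simp: act_def)
  obtain x y where xy: "w = vec2 x y" by (rule vec2_cases)
  have "vec2 0 0 = 0" by (simp add: vec_eq_iff forall_2)
  then have "x = 0 \<and> y = 0" using w(2) xy a by (auto simp: vec2_eq_iff simp flip: \<open>vec2 0 0 = 0\<close>)
  then show False using Lam_nonzero[OF w(1)] xy \<open>vec2 0 0 = 0\<close> by simp
qed

lemma Tpiece_least_slope_BCZ:
  assumes i: "i \<in> {2..q-1}" and p: "p \<in> Tpiece q i"
  shows "gpt p *v wv q i \<in> act (gpt p) (Lam q) \<inter> strip 1
      \<and> 0 < slope (gpt p *v wv q i)
      \<and> (\<forall>z \<in> act (gpt p) (Lam q) \<inter> strip 1. 0 < slope z \<longrightarrow> slope (gpt p *v wv q i) \<le> slope z)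
      \<and> Rq q p = (wv q i $ 2) / (fst p * pdot p (wv q i))
      \<and> BCZ q p = (pdot p (wv q i),
                   pdot p (wv q (i + 1)) + of_int (kq q i p) * lam q * pdot p (wv q i))"
proof -
  obtain a b where ab: "p = (a, b)" by (cases p)
  have i': "2 \<le> i" "i \<le> q - 1" using i by auto
  have "wv q i $ 2 = u i" by (simp add: wv_eq)
  then show ?thesis
    using Tpiece_min_slope(5,7,8)[OF i' p[unfolded ab]] Tpiece_BCZ(1,3)[OF i' p[unfolded ab]]
    by (simp add: ab gpt_def pdot_wv kq_def del: wv.simps)
qed

lemma Farey_no_short_horizontal:
  assumes p: "p \<in> Farey q" and min: "\<forall>z \<in> act (gpt p) (Lam q) \<inter> strip 1. 0 < slope z \<longrightarrow> r \<le> slope z"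
    and s: "0 < s" "s < r"
  shows "\<not> (\<exists>w \<in> act (hmat s ** gpt p) (Lam q). w $ 2 = 0 \<and> norm w \<le> 1)"
proof -
  obtain a b where g: "gpt p = gmat a b" and a: "0 < a"
    using p by (cases p) (auto simp: gpt_def Farey_def)
  have "\<not> (\<exists>w \<in> act (hmat s) (act (gpt p) (Lam q)). w $ 2 = 0 \<and> norm w \<le> 1)"
    by (rule no_short_horizontal_below_min_slope[OF _ _ min s])
       (use act_gmat_Lam_neg act_gmat_Lam_nonzero[OF a] in \<open>simp_all add: g\<close>)
  then show ?thesis by (simp add: act_mult)
qed

lemma Farey_BCZ:
  assumes p: "p \<in> Farey q"
  shows "act (gpt p) (Lam q) \<inter> strip 1 \<noteq> {}
      \<and> (\<exists>v \<in> act (gpt p) (Lam q) \<inter> strip 1. 0 < slope v \<and>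
           (\<forall>z \<in> act (gpt p) (Lam q) \<inter> strip 1. 0 < slope z \<longrightarrow> slope v \<le> slope z))
      \<and> 0 < Rq q p
      \<and> (\<exists>v \<in> act (hmat (Rq q p) ** gpt p) (Lam q). v $ 2 = 0 \<and> norm v \<le> 1)
      \<and> (\<forall>s. 0 < s \<and> s < Rq q p \<longrightarrow>
           \<not> (\<exists>v \<in> act (hmat s ** gpt p) (Lam q). v $ 2 = 0 \<and> norm v \<le> 1))
      \<and> (\<exists>!p'. p' \<in> Farey q \<and> act (hmat (Rq q p) ** gpt p) (Lam q) = act (gpt p') (Lam q))
      \<and> BCZ q p \<in> Farey q
      \<and> act (hmat (Rq q p) ** gpt p) (Lam q) = act (gpt (BCZ q p)) (Lam q)"
proof -
  obtain a b i where ab: "p = (a, b)" and i: "2 \<le> i" "i \<le> q - 1" and T: "(a, b) \<in> Tpiece q i"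
    using Tpiece_Union p by (cases p) fastforce
  define v where "v = gmat a b *v wv q i"
  have g: "gpt p = gmat a b" by (simp add: ab gpt_def)
  note min = Tpiece_min_slope[OF i T, folded v_def g]
  note formula = Tpiece_BCZ[OF i T, folded ab]
  have R: "Rq q p = slope v" using Rq_eqI min by blast
  have horiz: "vec2 (wdot q a b i) 0 \<in> act (hmat (Rq q p) ** gpt p) (Lam q)"
    using act_memI[OF wv_Lam[of q i], of "hmat (Rq q p) ** gpt p"] formula(2) by simp
  have "det (hmat (Rq q p) ** gpt p) = 1"
    using min(4) unfolding det_mul by (simp add: g hmat_def gmat_def)
  from normal_form[OF this min(2,3) horiz]
  have ex1: "\<exists>!p'. p' \<in> Farey q \<and> act (hmat (Rq q p) ** gpt p) (Lam q) = act (gpt p') (Lam q)"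
    by blast
  have no_short: "\<forall>s. 0 < s \<and> s < Rq q p \<longrightarrow>
      \<not> (\<exists>w \<in> act (hmat s ** gpt p) (Lam q). w $ 2 = 0 \<and> norm w \<le> 1)"
  proof (intro allI impI)
    fix s assume "0 < s \<and> s < Rq q p"
    then show "\<not> (\<exists>w \<in> act (hmat s ** gpt p) (Lam q). w $ 2 = 0 \<and> norm w \<le> 1)"
      using Farey_no_short_horizontal[OF p min(8), of s] R by simp
  qed
  have ne: "act (gpt p) (Lam q) \<inter> strip 1 \<noteq> {}" using min(5) by blast
  have least: "\<exists>v \<in> act (gpt p) (Lam q) \<inter> strip 1. 0 < slope v \<and>
      (\<forall>z \<in> act (gpt p) (Lam q) \<inter> strip 1. 0 < slope z \<longrightarrow> slope v \<le> slope z)"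
    using min(5,7,8) by blast
  have short: "\<exists>w \<in> act (hmat (Rq q p) ** gpt p) (Lam q). w $ 2 = 0 \<and> norm w \<le> 1"
    using horiz min(2,3) by (intro bexI[OF _ horiz]) (simp add: norm_vec2_0)
  have bcz: "BCZ q p \<in> Farey q \<and> act (hmat (Rq q p) ** gpt p) (Lam q) = act (gpt (BCZ q p)) (Lam q)"
    unfolding BCZ_def by (rule theI'[OF ex1])
  have "0 < Rq q p" using R min(7) by simp
  then show ?thesis using ne least short no_short ex1 bcz by (intro conjI) simp_all
qed

end

theorem mainTheorem5:
  fixes q :: nat
  assumes "q \<ge> 3"
  shows
    \<comment> \<open>(1)\<close>
    "(\<forall>(A :: real^2^2) c. det A = 1 \<and> 0 < c \<and> c \<le> 1 \<and> vec2 c 0 \<in> act A (Lam q) \<longrightarrow>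
        (\<exists>!p. p \<in> Farey q \<and> act A (Lam q) = act (gpt p) (Lam q)) \<and>
        (\<forall>p \<in> Farey q. act A (Lam q) = act (gpt p) (Lam q) \<longrightarrow> fst p = c))
   \<and> (\<forall>p \<in> Farey q. \<forall>p' \<in> Farey q.
        act (gpt p) (Lam q) = act (gpt p') (Lam q) \<longrightarrow> p = p')
    \<comment> \<open>(2)\<close>
   \<and> (\<forall>p \<in> Farey q.
        act (gpt p) (Lam q) \<inter> strip 1 \<noteq> {}
      \<and> (\<exists>v \<in> act (gpt p) (Lam q) \<inter> strip 1. 0 < slope v \<and>
           (\<forall>u \<in> act (gpt p) (Lam q) \<inter> strip 1. 0 < slope u \<longrightarrow> slope v \<le> slope u))
      \<and> 0 < Rq q p
      \<and> (\<exists>v \<in> act (hmat (Rq q p) ** gpt p) (Lam q). v $ 2 = 0 \<and> norm v \<le> 1)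
      \<and> (\<forall>s. 0 < s \<and> s < Rq q p \<longrightarrow>
           \<not> (\<exists>v \<in> act (hmat s ** gpt p) (Lam q). v $ 2 = 0 \<and> norm v \<le> 1))
      \<and> (\<exists>!p'. p' \<in> Farey q \<and> act (hmat (Rq q p) ** gpt p) (Lam q) = act (gpt p') (Lam q))
      \<and> BCZ q p \<in> Farey q
      \<and> act (hmat (Rq q p) ** gpt p) (Lam q) = act (gpt (BCZ q p)) (Lam q))
    \<comment> \<open>(3)\<close>
   \<and> (\<forall>i \<in> {2..q-1}. Tpiece q i \<noteq> {})
   \<and> (\<Union>i \<in> {2..q-1}. Tpiece q i) = Farey q
   \<and> (\<forall>i \<in> {2..q-1}. \<forall>j \<in> {2..q-1}. i \<noteq> j \<longrightarrow> Tpiece q i \<inter> Tpiece q j = {})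
   \<and> (\<forall>i \<in> {2..q-1}. \<forall>p \<in> Tpiece q i.
        gpt p *v wv q i \<in> act (gpt p) (Lam q) \<inter> strip 1
      \<and> 0 < slope (gpt p *v wv q i)
      \<and> (\<forall>u \<in> act (gpt p) (Lam q) \<inter> strip 1. 0 < slope u \<longrightarrow> slope (gpt p *v wv q i) \<le> slope u)
      \<and> Rq q p = (wv q i $ 2) / (fst p * pdot p (wv q i))
      \<and> BCZ q p = (pdot p (wv q i),
                   pdot p (wv q (i + 1)) + real_of_int (kq q i p) * lam q * pdot p (wv q i)))"
proof -
  interpret hecke q using assms by unfold_locales
  show ?thesis
  proof (intro conjI)
    show "\<forall>i \<in> {2..q-1}. Tpiece q i \<noteq> {}" using Tpiece_nonempty by auto
    show "(\<Union>i \<in> {2..q-1}. Tpiece q i) = Farey q" by (rule Tpiece_Union)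
    show "\<forall>i \<in> {2..q-1}. \<forall>j \<in> {2..q-1}. i \<noteq> j \<longrightarrow> Tpiece q i \<inter> Tpiece q j = {}"
      using Tpiece_disjoint by blast
  qed (use normal_form in blast, use Farey_gpt_act_inj in blast,
       (intro ballI, erule Farey_BCZ), (intro ballI, erule Tpiece_least_slope_BCZ))
qed

end
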